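(* Let $G \in \mathbb{R}^{n\times n}$ be a symmetric positive semidefinite matrix with $\operatorname{rank}(G) = r$. Suppose the oASIS algorithm, run on $G$, chooses $r$ columns of $G$; that is, at some stage of the run the set $\Lambda\subseteq\{1,\dots,n\}$ of sampled column indices satisfies $|\Lambda| = r$. Then the Nyström approximation $\widetilde G = C W^{\dagger} C^T$ built from these columns, where $C = G(:,\Lambda)$ and $W = G(\Lambda,\Lambda)$, satisfies $\widetilde G = G$.
   Context: Notation. For a matrix $G$ and index set $\Lambda\subseteq\{1,\dots,n\}$, $G(:,\Lambda)$ is the $n\times|\Lambda|$ submatrix of columns indexed by $\Lambda$, $G(\Lambda,\Lambda)$ is the $|\Lambda|\times|\Lambda|$ submatrix of rows and columns indexed by $\Lambda$, and $A^\dagger$ is the Moore–Penrose pseudo-inverse of $A$. Nyström approximation. For a symmetric positive semidefinite $G\in\mathbb{R}^{n\times n}$ and an index set $\Lambda$, put $C=G(:,\Lambda)$ and $W=G(\Lambda,\Lambda)$; the Nyström approximation of $G$ from the columns $\Lambda$ is $\widetilde G = C W^\dagger C^T$. oASIS algorithm. Inputs: $G$, its diagonal entries $d_i=G(i,i)$, a maximum number $\ell$ of columns, an initial number $k<\ell$ of columns, and a stopping tolerance $\epsilon\ge 0$. Start with a set $\Lambda$ of $k$ distinct indices (chosen at random) for which $G(\Lambda,\Lambda)$ is invertible. While $|\Lambda|<\ell$, do the following: with $C=G(:,\Lambda)$, $W=G(\Lambda,\Lambda)$, and $b_i^T$ denoting row $i$ of $C$, compute $$\Delta(i) = d_i - b_i^T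 W^{-1} b_i \qquad (i\notin\Lambda);$$ choose $i\notin\Lambda$ maximizing $|\Delta(i)|$; if $|\Delta(i)|<\epsilon$ or $\Delta(i)=0$, terminate; otherwise replace $\Lambda$ by $\Lambda\cup\{i\}$ and continue. The columns chosen by oASIS are the columns of $G$ indexed by $\Lambda$ (the initial ones and those added subsequently). When an index $i$ is added, the new matrix $G(\Lambda\cup\{i\},\Lambda\cup\{i\})$ is again invertible because $\Delta(i)\neq 0$, so $W^{-1}$ is well defined throughout. *)

theory Defs
  imports
    "Jordan_Normal_Form.DL_Submatrix"
    "Jordan_Normal_Form.DL_Rank"
    "Jordan_Normal_Form.Gauss_Jordan_Elimination"
begin

(* Matrices and index sets are 0-based: the index set {1,...,n} becomes {..<n}.
   submatrix lists the selected rows and columns in increasing order of index. *)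

definition psd_mat :: "real mat \<Rightarrow> bool" where
  "psd_mat A \<longleftrightarrow> square_mat A \<and>
     (\<forall>x \<in> carrier_vec (dim_row A). x \<bullet> (A *\<^sub>v x) \<ge> 0)"

definition is_pinv :: "real mat \<Rightarrow> real mat \<Rightarrow> bool" where
  "is_pinv A X \<longleftrightarrow> X \<in> carrier_mat (dim_col A) (dim_row A) \<and>
     A * X * A = A \<and> X * A * X = X \<and>
     (A * X)\<^sup>T = A * X \<and> (X * A)\<^sup>T = X * A"

(* The four Penrose equations have exactly one solution, so THE is well defined. *)
definition pinv :: "real mat \<Rightarrow> real mat" where
  "pinv A = (THE X. is_pinv A X)"

definition sel_cols :: "real mat \<Rightarrow> nat set \<Rightarrow> real mat" where
  "sel_cols G L = submatrix G UNIV L"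

definition nystrom :: "real mat \<Rightarrow> nat set \<Rightarrow> real mat" where
  "nystrom G L = sel_cols G L * pinv (submatrix G L L) * (sel_cols G L)\<^sup>T"

(* Only meaningful when G(L,L) is invertible; otherwise mat_inverse returns None. *)
definition oasis_delta :: "real mat \<Rightarrow> nat set \<Rightarrow> nat \<Rightarrow> real" where
  "oasis_delta G L i =
     G $$ (i, i) - row (sel_cols G L) i \<bullet>
       (the (mat_inverse (submatrix G L L)) *\<^sub>v row (sel_cols G L) i)"

(* oasis_sampled G l k \<epsilon> L: some run on G, with column limit l, k initial columns and
   tolerance \<epsilon>, has L as its set of sampled indices at some stage. The random initial
   set and the choice among several maximizers are both left nondeterministic. *)
inductive oasis_sampled :: "real mat \<Rightarrow> nat \<Rightarrow> nat \<Rightarrow> real \<Rightarrow> nat set \<Rightarrow> bool"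
  for G :: "real mat" and l k :: nat and \<epsilon> :: real
where
  init: "\<lbrakk> L \<subseteq> {..<dim_row G}; card L = k; invertible_mat (submatrix G L L) \<rbrakk>
    \<Longrightarrow> oasis_sampled G l k \<epsilon> L"
| step: "\<lbrakk> oasis_sampled G l k \<epsilon> L; card L < l;
      i \<in> {..<dim_row G} - L;
      \<forall>j \<in> {..<dim_row G} - L. \<bar>oasis_delta G L j\<bar> \<le> \<bar>oasis_delta G L i\<bar>;
      \<not> (\<bar>oasis_delta G L i\<bar> < \<epsilon> \<or> oasis_delta G L i = 0) \<rbrakk>
    \<Longrightarrow> oasis_sampled G l k \<epsilon> (insert i L)"

end

theory Submission
  imports Defs "Jordan_Normal_Form.DL_Rank_Submatrix"
begin

text \<open>If \<open>G(\<Lambda>,\<Lambda>)\<close> is nonsingular and some Schur complement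
  \<open>G(i,j) - G(i,\<Lambda>) G(\<Lambda>,\<Lambda>)\<^sup>-\<^sup>1 G(\<Lambda>,j)\<close> is nonzero, then the minor of \<open>G\<close> on the rows \<open>\<Lambda> \<union> {i}\<close>
  and columns \<open>\<Lambda> \<union> {j}\<close> is nonzero. With \<open>i = j\<close> this shows that every oASIS step keeps
  \<open>G(\<Lambda>,\<Lambda>)\<close> invertible. With \<open>card \<Lambda> = rank G\<close> such a minor would exceed the rank, so all Schur
  complements vanish, which is the claim entry by entry.\<close>

section \<open>Submatrices and bordered minors, addressed by elements of the index sets\<close>

lemma card_less_in_set:
  assumes "finite L" "(b::nat) \<in> L"
  shows "card {a \<in> L. a < b} < card L"
  using assms by (intro psubset_card_mono) auto

text \<open>\<open>pick L\<close> and counting the smaller elements of \<open>L\<close> are inverse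
  to each other. This turns sums over positions in a submatrix into sums over \<open>L\<close>
  itself.\<close>

lemma bij_betw_pick:
  assumes "finite L"
  shows "bij_betw (pick L) {..<card L} L"
proof (rule bij_betw_byWitness[where f' = "\<lambda>b. card {a \<in> L. a < b}"])
  show "\<forall>t\<in>{..<card L}. card {a \<in> L. a < pick L t} = t"
    by (simp add: card_pick)
  show "\<forall>b\<in>L. pick L (card {a \<in> L. a < b}) = b"
    by (simp add: pick_card_in_set)
  show "pick L ` {..<card L} \<subseteq> L"
    by (auto intro: pick_in_set)
  show "(\<lambda>b. card {a \<in> L. a < b}) ` L \<subseteq> {..<card L}"
    using card_less_in_set[OF assms] by auto
qed

lemma sum_pick:
  assumes "finite L"
  shows "(\<Sum>b\<in>L. f b) = (\<Sum>t<card L. f (pick L t))"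
  by (rule sum.reindex_bij_betw[OF bij_betw_pick[OF assms], symmetric])

lemma card_index_set:
  assumes "L \<subseteq> {..<n}"
  shows "card {i. i < n \<and> i \<in> L} = card L"
proof -
  have "{i. i < n \<and> i \<in> L} = L"
    using assms by auto
  then show ?thesis by simp
qed

lemma submatrix_carrier:
  assumes "A \<in> carrier_mat nr nc" "I \<subseteq> {..<nr}" "J \<subseteq> {..<nc}"
  shows "submatrix A I J \<in> carrier_mat (card I) (card J)"
  using assms by (auto simp: dim_submatrix card_index_set)

text \<open>The bound on \<open>s\<close> is not \<open>card I\<close>, because
  \<open>sel_cols\<close> takes \<open>I = UNIV\<close>, whose \<open>card\<close> is 0.\<close>

lemma row_submatrix_scalar_prod:
  fixes A :: "'a :: comm_semiring_0 mat"
  assumes A: "A \<in> carrier_mat nr nc" and J: "J \<subseteq> {..<nc}"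
    and s: "s < card {i. i < nr \<and> i \<in> I}" and v: "v \<in> carrier_vec (card J)"
  shows "row (submatrix A I J) s \<bullet> v
    = (\<Sum>b\<in>J. A $$ (pick I s, b) * v $ card {a \<in> J. a < b})"
proof -
  have fin: "finite J" using J finite_subset by blast
  have "row (submatrix A I J) s \<bullet> v = (\<Sum>t<card J. A $$ (pick I s, pick J t) * v $ t)"
    using A J s v
    by (auto simp: scalar_prod_def submatrix_def card_index_set lessThan_atLeast0 intro!: sum.cong)
  also have "\<dots> = (\<Sum>t<card J. A $$ (pick I s, pick J t) * v $ card {a \<in> J. a < pick J t})"
    by (intro sum.cong) (auto simp: card_pick)
  finally show ?thesis
    by (simp add: sum_pick[OF fin])
qed

text \<open>Nonsingularity is triviality of the kernel. Kernel vectors are written as functions on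
  \<open>J\<close> rather than by position, so that inserting a new index into \<open>J\<close> does
  not renumber the old entries.\<close>

lemma det_submatrix_nonzero_iff:
  fixes A :: "'a :: field mat"
  assumes A: "A \<in> carrier_mat nr nc" and I: "I \<subseteq> {..<nr}" and J: "J \<subseteq> {..<nc}"
    and card: "card I = card J"
  shows "det (submatrix A I J) \<noteq> 0 \<longleftrightarrow>
    (\<forall>x. (\<forall>a\<in>I. (\<Sum>b\<in>J. A $$ (a, b) * x b) = 0) \<longrightarrow> (\<forall>b\<in>J. x b = 0))"
    (is "?det \<longleftrightarrow> ?inj")
proof -
  let ?S = "submatrix A I J"
  have finI: "finite I" and finJ: "finite J" using I J finite_subset by blast+
  have S: "?S \<in> carrier_mat (card J) (card J)"
    using submatrix_carrier[OF A I J] card by simp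
  have row: "(?S *\<^sub>v v) $ s = (\<Sum>b\<in>J. A $$ (pick I s, b) * v $ card {a \<in> J. a < b})"
    if "s < card J" "v \<in> carrier_vec (card J)" for s v
    using that S row_submatrix_scalar_prod[OF A J, of s I v] I card by (simp add: card_index_set)
  show ?thesis
  proof
    assume det: ?det
    show ?inj
    proof (intro allI impI)
      fix x assume x: "\<forall>a\<in>I. (\<Sum>b\<in>J. A $$ (a, b) * x b) = 0"
      define v where "v = vec (card J) (\<lambda>t. x (pick J t))"
      have v: "v \<in> carrier_vec (card J)" by (simp add: v_def)
      have vx: "v $ card {a \<in> J. a < b} = x b" if "b \<in> J" for b
        using that by (simp add: v_def card_less_in_set[OF finJ] pick_card_in_set)
      have "?S *\<^sub>v v = 0\<^sub>v (card J)"
      proof (rule eq_vecI)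
        fix s assume "s < dim_vec (0\<^sub>v (card J) :: 'a vec)"
        then have s: "s < card J" by simp
        then have "pick I s \<in> I" by (simp add: card pick_in_set)
        then show "(?S *\<^sub>v v) $ s = 0\<^sub>v (card J) $ s"
          using s x by (simp add: row[OF s v] vx)
      qed (use S in simp)
      then have "v = 0\<^sub>v (card J)"
        using det det_0_iff_vec_prod_zero_field[OF S] v by blast
      then show "\<forall>b\<in>J. x b = 0"
        using vx card_less_in_set[OF finJ] by (metis index_zero_vec(1))
    qed
  next
    assume inj: ?inj
    show ?det
    proof
      assume "det ?S = 0"
      then obtain v where v: "v \<in> carrier_vec (card J)" "v \<noteq> 0\<^sub>v (card J)"
        and Sv: "?S *\<^sub>v v = 0\<^sub>v (card J)"
        using det_0_iff_vec_prod_zero_field[OF S] by blast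
      have "(\<Sum>b\<in>J. A $$ (a, b) * v $ card {c \<in> J. c < b}) = 0" if "a \<in> I" for a
        using row[of "card {c \<in> I. c < a}" v] v Sv that card_less_in_set[OF finI that]
        by (simp add: card pick_card_in_set)
      then have "\<forall>b\<in>J. v $ card {c \<in> J. c < b} = 0"
        using inj[rule_format, of "\<lambda>b. v $ card {c \<in> J. c < b}"] by blast
      then have "v $ t = 0" if "t < card J" for t
        using that by (metis card_pick pick_in_set)
      then have "v = 0\<^sub>v (card J)"
        using v(1) by (intro eq_vecI) auto
      with v(2) show False by simp
    qed
  qed
qed

text \<open>This is elimination on a bordered matrix: the rows in \<open>I\<close> express a kernel
  vector \<open>x\<close> through the single value \<open>x j\<close>, and row \<open>i\<close> then
  says that \<open>x j\<close> times the Schur complement is 0.\<close>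

lemma det_submatrix_insert_nonzero:
  fixes A :: "'a :: field mat"
  assumes A: "A \<in> carrier_mat nr nc" and I: "insert i I \<subseteq> {..<nr}" and J: "insert j J \<subseteq> {..<nc}"
    and card: "card I = card J" and i: "i \<notin> I" and j: "j \<notin> J"
    and det: "det (submatrix A I J) \<noteq> 0"
    and y: "\<And>a. a \<in> I \<Longrightarrow> (\<Sum>b\<in>J. A $$ (a, b) * y b) = A $$ (a, j)"
    and schur: "A $$ (i, j) \<noteq> (\<Sum>b\<in>J. A $$ (i, b) * y b)"
  shows "det (submatrix A (insert i I) (insert j J)) \<noteq> 0"
proof -
  have finI: "finite I" and finJ: "finite J" 
    using I J by (auto intro: finite_subset[of _ "{..<nr}"] finite_subset[of _ "{..<nc}"])
  have inj: "\<forall>b\<in>J. z b = 0" if "\<And>a. a \<in> I \<Longrightarrow> (\<Sum>b\<in>J. A $$ (a, b) * z b) = 0" for z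
    using det det_submatrix_nonzero_iff[OF A _ _ card] I J that by auto
  have "\<forall>b\<in>insert j J. x b = 0"
    if x: "\<forall>a\<in>insert i I. (\<Sum>b\<in>insert j J. A $$ (a, b) * x b) = 0" for x
  proof -
    have x': "A $$ (a, j) * x j + (\<Sum>b\<in>J. A $$ (a, b) * x b) = 0" if "a \<in> insert i I" for a
      using bspec[OF x that] j finJ by simp
    have comb: "(\<Sum>b\<in>J. A $$ (a, b) * (x b + x j * y b))
      = (\<Sum>b\<in>J. A $$ (a, b) * x b) + x j * (\<Sum>b\<in>J. A $$ (a, b) * y b)" for a
      by (simp add: sum.distrib sum_distrib_left algebra_simps)
    \<comment> \<open>On the rows in \<open>I\<close>, column \<open>j\<close> equals the
      combination of the columns in \<open>J\<close> with coefficients \<open>y\<close>, so its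
      contribution \<open>x j\<close> can be absorbed into the entries on \<open>J\<close>.\<close>
    have "\<forall>b\<in>J. x b + x j * y b = 0"
    proof (rule inj)
      fix a assume a: "a \<in> I"
      then show "(\<Sum>b\<in>J. A $$ (a, b) * (x b + x j * y b)) = 0"
        using x'[of a] unfolding comb y[OF a] by (simp add: add.commute mult.commute)
    qed
    then have xb: "x b = - (x j * y b)" if "b \<in> J" for b
      using that by (simp add: eq_neg_iff_add_eq_0)
    have "x j * (A $$ (i, j) - (\<Sum>b\<in>J. A $$ (i, b) * y b)) = 0"
    proof -
      have "(\<Sum>b\<in>J. A $$ (i, b) * x b) = - (x j * (\<Sum>b\<in>J. A $$ (i, b) * y b))"
        by (simp add: xb sum_distrib_left sum_negf mult.left_commute)
      then show ?thesis
        using x'[of i] by (simp add: right_diff_distrib mult.commute)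
    qed
    then have "x j = 0"
      using schur by simp
    then show ?thesis
      using xb by simp
  qed
  moreover have "card (insert i I) = card (insert j J)"
    using card i j finI finJ by simp
  ultimately show ?thesis
    using det_submatrix_nonzero_iff[OF A I J] by blast
qed

section \<open>Inverses, determinants and the pseudo-inverse\<close>

lemma invertible_mat_iff_det:
  fixes A :: "'a :: field mat"
  assumes A: "A \<in> carrier_mat n n"
  shows "invertible_mat A \<longleftrightarrow> det A \<noteq> 0"
proof
  assume "invertible_mat A"
  then obtain B where "A * B = 1\<^sub>m n" and BA: "B * A = 1\<^sub>m (dim_row B)"
    using A by (auto simp: invertible_mat_def inverts_mat_def)
  \<comment> \<open>\<open>invertible_mat\<close> does not fix the shape of \<open>B\<close>;
    comparing the column counts in the two products does.\<close>
  moreover from BA have "B \<in> carrier_mat n n"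
    using A \<open>A * B = 1\<^sub>m n\<close>
    by (metis carrier_matD(2) carrier_matI index_mult_mat(3) index_one_mat(3))
  ultimately show "det A \<noteq> 0"
    using A det_mult[of A n B] by auto
next
  assume "det A \<noteq> 0"
  from det_non_zero_imp_unit[OF A this]
  obtain B where "B \<in> carrier_mat n n" "A * B = 1\<^sub>m n" "B * A = 1\<^sub>m n"
    unfolding Units_def by (auto simp: ring_mat_def)
  then show "invertible_mat A"
    using A by (auto simp: invertible_mat_def inverts_mat_def)
qed

lemma mat_inverse_det_nonzero:
  assumes A: "A \<in> carrier_mat n n" and "det A \<noteq> 0"
  obtains B where "mat_inverse A = Some B" "B \<in> carrier_mat n n" "A * B = 1\<^sub>m n" "B * A = 1\<^sub>m n"
  using mat_inverse[OF A] det_non_zero_imp_unit[OF assms] by (metis not_Some_eq)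

text \<open>A two-sided inverse satisfies all four Penrose equations. For uniqueness the first one
  suffices: multiply \<open>A * X * A = A\<close> by \<open>B\<close> on both sides.\<close>

lemma pinv_eq_inverse:
  assumes A: "A \<in> carrier_mat n n" and B: "B \<in> carrier_mat n n"
    and AB: "A * B = 1\<^sub>m n" and BA: "B * A = 1\<^sub>m n"
  shows "pinv A = B"
  unfolding pinv_def
proof (rule the_equality)
  show "is_pinv A B"
    using assms by (simp add: is_pinv_def)
  fix X assume "is_pinv A X"
  then have X: "X \<in> carrier_mat n n" and AXA: "A * X * A = A"
    using A by (auto simp: is_pinv_def)
  have "X = (B * A) * X * (A * B)"
    using X by (simp add: AB BA)
  also have "\<dots> = B * (A * X * A) * B"
    using A B X by (simp add: assoc_mult_mat[of _ n n _ n _ n])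
  also have "\<dots> = B"
    unfolding AXA using B by (simp add: BA)
  finally show "X = B" .
qed

text \<open>The solution of \<open>G(\<Lambda>,\<Lambda>) y = G(\<Lambda>,j)\<close>, re-indexed from positions in \<open>\<Lambda>\<close> to elements of \<open>\<Lambda>\<close>.\<close>

definition col_coeff :: "real mat \<Rightarrow> nat set \<Rightarrow> nat \<Rightarrow> nat \<Rightarrow> real" where
  "col_coeff G L j b =
    (the (mat_inverse (submatrix G L L)) *\<^sub>v row (sel_cols G L) j) $ card {a \<in> L. a < b}"

section \<open>Nystrom entries for a nonsingular principal submatrix\<close>

context
  fixes G :: "real mat" and n :: nat and L :: "nat set"
  assumes G: "G \<in> carrier_mat n n" and sym: "G\<^sup>T = G" and L: "L \<subseteq> {..<n}"
    and det: "det (submatrix G L L) \<noteq> 0"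
begin

lemma sel_cols_carrier: "sel_cols G L \<in> carrier_mat n (card L)"
  using submatrix_carrier[OF G order.refl L] G L
  by (auto simp: sel_cols_def dim_submatrix card_index_set)

text \<open>With \<open>i = j\<close> this is the term subtracted in \<open>oasis_delta\<close>; for
  general \<open>i\<close> and \<open>j\<close> it is an entry of the Nystrom approximation. Both
  uses thus share the same coefficients.\<close>

lemma sel_cols_row_scalar_prod:
  assumes "i < n" "j < n"
  shows "row (sel_cols G L) i \<bullet> (the (mat_inverse (submatrix G L L)) *\<^sub>v row (sel_cols G L) j)
    = (\<Sum>b\<in>L. G $$ (i, b) * col_coeff G L j b)"
proof -
  have W: "submatrix G L L \<in> carrier_mat (card L) (card L)"
    by (rule submatrix_carrier[OF G L L])
  obtain B where B: "mat_inverse (submatrix G L L) = Some B" "B \<in> carrier_mat (card L) (card L)"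
    using mat_inverse_det_nonzero[OF W det] by metis
  moreover have "row (sel_cols G L) j \<in> carrier_vec (card L)"
    using sel_cols_carrier by (metis row_carrier carrier_matD(2))
  ultimately show ?thesis
    using row_submatrix_scalar_prod[OF G L, of i UNIV "B *\<^sub>v row (sel_cols G L) j"] assms
    by (simp add: sel_cols_def col_coeff_def pick_UNIV)
qed

lemma col_coeff_eq:
  assumes j: "j < n" and a: "a \<in> L"
  shows "(\<Sum>b\<in>L. G $$ (a, b) * col_coeff G L j b) = G $$ (a, j)"
proof -
  let ?W = "submatrix G L L" and ?c = "row (sel_cols G L) j" and ?s = "card {b \<in> L. b < a}"
  have fin: "finite L" using L finite_subset by blast
  have W: "?W \<in> carrier_mat (card L) (card L)"
    by (rule submatrix_carrier[OF G L L])
  obtain B where B: "mat_inverse ?W = Some B" "B \<in> carrier_mat (card L) (card L)"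
    and WB: "?W * B = 1\<^sub>m (card L)"
    using mat_inverse_det_nonzero[OF W det] by metis
  have c: "?c \<in> carrier_vec (card L)"
    using sel_cols_carrier by (metis row_carrier carrier_matD(2))
  have s: "?s < card L" by (rule card_less_in_set[OF fin a])
  have an: "a < n" using a L by auto
  have "(\<Sum>b\<in>L. G $$ (a, b) * col_coeff G L j b) = row ?W ?s \<bullet> (B *\<^sub>v ?c)"
    using row_submatrix_scalar_prod[OF G L, of ?s L "B *\<^sub>v ?c"] s B c a L
    by (simp add: col_coeff_def card_index_set pick_card_in_set)
  also have "\<dots> = (?W *\<^sub>v (B *\<^sub>v ?c)) $ ?s"
    using W s by simp
  also have "?W *\<^sub>v (B *\<^sub>v ?c) = ?c"
    using W B c WB by (metis assoc_mult_mat_vec one_mult_mat_vec)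
  \<comment> \<open>The right-hand side of the system is a row of \<open>sel_cols G L\<close>, hence
    part of row \<open>j\<close> of \<open>G\<close>; symmetry makes it part of column
    \<open>j\<close>.\<close>
  also have "?c $ ?s = G $$ (j, a)"
    using j s a G L sel_cols_carrier
    by (simp add: sel_cols_def submatrix_def card_index_set pick_UNIV pick_card_in_set)
  also have "\<dots> = G $$ (a, j)"
    using sym G j an by (metis carrier_matD index_transpose_mat(1))
  finally show ?thesis .
qed

lemma nystrom_index:
  assumes i: "i < n" and j: "j < n"
  shows "nystrom G L $$ (i, j) = (\<Sum>b\<in>L. G $$ (i, b) * col_coeff G L j b)"
proof -
  let ?W = "submatrix G L L" and ?C = "sel_cols G L"
  have W: "?W \<in> carrier_mat (card L) (card L)"
    by (rule submatrix_carrier[OF G L L])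
  obtain B where B: "mat_inverse ?W = Some B" "B \<in> carrier_mat (card L) (card L)"
    and inv: "?W * B = 1\<^sub>m (card L)" "B * ?W = 1\<^sub>m (card L)"
    using mat_inverse_det_nonzero[OF W det] by metis
  note C = sel_cols_carrier
  have "nystrom G L = ?C * (B * ?C\<^sup>T)"
    unfolding nystrom_def pinv_eq_inverse[OF W B(2) inv]
    using C B by (intro assoc_mult_mat) auto
  moreover have "col (B * ?C\<^sup>T) j = B *\<^sub>v row ?C j"
    using B C j by (subst col_mult2) auto
  ultimately have "nystrom G L $$ (i, j) = row ?C i \<bullet> (B *\<^sub>v row ?C j)"
    using B C i j by auto
  then show ?thesis
    using sel_cols_row_scalar_prod[OF i j] B by simp
qed

lemma nystrom_eq:
  assumes rank: "vec_space.rank n G \<le> card L"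
  shows "nystrom G L = G"
proof (rule eq_matI)
  have C: "sel_cols G L \<in> carrier_mat n (card L)" by (rule sel_cols_carrier)
  show "dim_row (nystrom G L) = dim_row G" "dim_col (nystrom G L) = dim_col G"
    using G C by (auto simp: nystrom_def)
  have fin: "finite L" using L finite_subset by blast
  fix i j assume "i < dim_row G" "j < dim_col G"
  then have i: "i < n" and j: "j < n" using G by auto
  have "(\<Sum>b\<in>L. G $$ (i, b) * col_coeff G L j b) = G $$ (i, j)"
  proof (cases "i \<in> L")
    case True
    then show ?thesis by (rule col_coeff_eq[OF j])
  next
    case iL: False
    show ?thesis
    proof (cases "j \<in> L")
      case True
      \<comment> \<open>For \<open>j\<close> in \<open>L\<close> the unit vector at \<open>j\<close>
        solves the same system as the coefficients. Nonsingularity makes the two equal, and then the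
        identity holds in row \<open>i\<close> outside \<open>L\<close> as well.\<close>
      let ?e = "\<lambda>b. of_bool (b = j) :: real"
      have delta: "(\<Sum>b\<in>L. G $$ (a, b) * ?e b) = G $$ (a, j)" for a
        using sum.remove[OF fin True, of "\<lambda>b. G $$ (a, b) * ?e b"] by simp
      have "(\<Sum>b\<in>L. G $$ (a, b) * (col_coeff G L j b - ?e b)) = 0" if "a \<in> L" for a
        by (simp only: right_diff_distrib sum_subtractf delta col_coeff_eq[OF j that] diff_self)
      then have "\<forall>b\<in>L. col_coeff G L j b - ?e b = 0"
        using det_submatrix_nonzero_iff[OF G L L refl, THEN iffD1, OF det, THEN spec,
            of "\<lambda>b. col_coeff G L j b - ?e b"] by blast
      then have "(\<Sum>b\<in>L. G $$ (i, b) * col_coeff G L j b) = (\<Sum>b\<in>L. G $$ (i, b) * ?e b)"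
        by (intro sum.cong) auto
      then show ?thesis
        by (simp only: delta)
    next
      case jL: False
      show ?thesis
      proof (rule ccontr)
        assume "\<not> ?thesis"
        then have "det (submatrix G (insert i L) (insert j L)) \<noteq> 0"
          using i j L
          by (intro det_submatrix_insert_nonzero[OF G _ _ refl iL jL det col_coeff_eq[OF j]]) auto
        \<comment> \<open>The nonzero minor has order \<open>card L + 1\<close>, one more than the
          rank allows. It need not be principal, as \<open>i\<close> and \<open>j\<close> may
          differ.\<close>
        then have "card {b. b < n \<and> b \<in> insert j L} \<le> vec_space.rank n G"
          using vec_space.rank_gt_minor[OF G] by metis
        moreover have "card {b. b < n \<and> b \<in> insert j L} = Suc (card L)"
          using card_index_set[of "insert j L" n] j jL L fin by simp
        ultimately show False using rank by simp
      qed
    qed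
  qed
  then show "nystrom G L $$ (i, j) = G $$ (i, j)"
    by (simp add: nystrom_index[OF i j])
qed

end

section \<open>Invertibility along a run of oASIS\<close>

lemma oasis_sampled_invertible:
  assumes "oasis_sampled G l k \<epsilon> L" and G: "G \<in> carrier_mat n n" and sym: "G\<^sup>T = G"
  shows "L \<subseteq> {..<n} \<and> det (submatrix G L L) \<noteq> 0"
  using assms(1)
proof (induction rule: oasis_sampled.induct)
  case (init L)
  then have "L \<subseteq> {..<n}" using G by simp
  with init show ?case
    using invertible_mat_iff_det[OF submatrix_carrier[OF G]] by blast
next
  case (step L i)
  then have L: "L \<subseteq> {..<n}" and det: "det (submatrix G L L) \<noteq> 0" by auto
  have i: "i < n" "i \<notin> L" using step G by auto
  \<comment> \<open>The difference of the two sides is \<open>oasis_delta G L i\<close>, which is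
    nonzero because the run did not stop here. It is the Schur complement for the diagonal border at
    \<open>i\<close>.\<close>
  have "G $$ (i, i) \<noteq> (\<Sum>b\<in>L. G $$ (i, b) * col_coeff G L i b)"
    using step.hyps sel_cols_row_scalar_prod[OF G sym L det i(1) i(1)]
    by (simp add: oasis_delta_def)
  then have "det (submatrix G (insert i L) (insert i L)) \<noteq> 0"
    using i L
    by (intro det_submatrix_insert_nonzero[OF G _ _ refl i(2) i(2) det
          col_coeff_eq[OF G sym L det i(1)]]) auto
  then show ?case using i L by simp
qed

theorem theorem1:
  fixes G :: "real mat" and n r k l :: nat and \<epsilon> :: real and \<Lambda> :: "nat set"
  assumes "G \<in> carrier_mat n n"
    and "G\<^sup>T = G"
    and "psd_mat G"
    and "vec_space.rank n G = r"
    and "k < l"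
    and "\<epsilon> \<ge> 0"
    and "oasis_sampled G l k \<epsilon> \<Lambda>"
    and "card \<Lambda> = r"
  shows "nystrom G \<Lambda> = G"
proof (rule nystrom_eq)
  show "\<Lambda> \<subseteq> {..<n}" "det (submatrix G \<Lambda> \<Lambda>) \<noteq> 0"
    using oasis_sampled_invertible[OF assms(7,1,2)] by simp_all
  show "vec_space.rank n G \<le> card \<Lambda>"
    by (simp only: assms(4,8) order.refl)
qed (use assms(1,2) in simp_all)

end
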